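(* Let $D$ be a simple directed graph on $n\ge 2$ vertices and $m$ edges, with out-degree sequence $d^+_1,\ldots,d^+_n$. Then $$\mathrm{allarb}(D) \leq \left(\frac{1}{n-1}\right)^{\frac{n-1}{2}}\left(\sum_{i=1}^n (d^+_i)^2 + m\right)^{\frac{n-1}{2}}.$$ In particular, if $G$ is a simple Eulerian graph on $n\ge 2$ vertices and $m$ edges with degree sequence $d_1,\dots,d_n$, and $O$ is an Eulerian orientation of $G$, then $$\mathrm{arb}(O) \leq \frac{1}{n}\left(\frac{1}{n-1}\right)^{\frac{n-1}{2}}\left(\frac{1}{4}\sum_{i=1}^n d_i^2 + m\right)^{\frac{n-1}{2}}.$$
   Context: A simple directed graph has no loops and at most one edge from $u$ to $v$ for each ordered pair $(u,v)$ of vertices. An arborescence of a directed graph $D$ rooted at a vertex $v$ is a spanning tree of $D$ in which every vertex different from $v$ has out-degree $1$ and $v$ has out-degree $0$ (every edge is oriented towards the root). $\mathrm{arb}(D,v)$ is the number of arborescences of $D$ rooted at $v$, and $\mathrm{allarb}(D)=\sum_{v\in V}\mathrm{arb}(D,v)$. An undirected graph is Eulerian if all degrees are even; an orientation (or a digraph) is Eulerian if every vertex has equal in-degree and out-degree. For an Eulerian digraph $D$ the number $\mathrm{arb}(D,v)$ does not depend on $v$ and is denoted $\mathrm{arb}(D)$. *)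

theory Defs
  imports Complex_Main "Graph_Theory.Digraph_Component"
begin

text \<open>
  The library's \<open>forest\<close> (hence also \<open>tree\<close> and \<open>spanning_tree\<close>) only excludes directed
  cycles, whereas a spanning tree must have no cycle in its underlying undirected (multi)graph.
  Such a cycle is a cycle of the digraph in which every arc may be traversed in both directions
  (the flag is \<open>True\<close> for a traversal from tail to head), using no arc twice. In particular
  a pair of antiparallel arcs forms a cycle, but running along one arc and back does not.
\<close>

definition both_ways :: "('a, 'b) pre_digraph \<Rightarrow> ('a, 'b \<times> bool) pre_digraph" where
  "both_ways H =
     \<lparr> verts = verts H,
       arcs = arcs H \<times> UNIV,
       tail = (\<lambda>(e, fwd). if fwd then tail H e else head H e),
       head = (\<lambda>(e, fwd). if fwd then head H e else tail H e) \<rparr>"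

definition undirected_cycle :: "('a, 'b) pre_digraph \<Rightarrow> ('b \<times> bool) list \<Rightarrow> bool" where
  "undirected_cycle H p \<longleftrightarrow> pre_digraph.cycle (both_ways H) p \<and> distinct (map fst p)"

definition underlying_tree :: "('a, 'b) pre_digraph \<Rightarrow> bool" where
  "underlying_tree H \<longleftrightarrow> connected H \<and> \<not> (\<exists>p. undirected_cycle H p)"

definition arborescence :: "('a, 'b) pre_digraph \<Rightarrow> 'a \<Rightarrow> ('a, 'b) pre_digraph \<Rightarrow> bool" where
  "arborescence D v T \<longleftrightarrow>
     spanning T D \<and> underlying_tree T \<and> v \<in> verts D \<and> out_degree T v = 0 \<and>
     (\<forall>u \<in> verts D. u \<noteq> v \<longrightarrow> out_degree T u = 1)"

definition arb :: "('a, 'b) pre_digraph \<Rightarrow> 'a \<Rightarrow> nat" where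
  "arb D v = card {T. arborescence D v T}"

definition allarb :: "('a, 'b) pre_digraph \<Rightarrow> nat" where
  "allarb D = (\<Sum>v \<in> verts D. arb D v)"

text \<open>
  A simple undirected graph is the library's \<open>graph\<close>, a symmetric simple digraph. Each edge is
  then represented by two opposite arcs, so edges are counted as unordered pairs of ends.
\<close>

definition edges :: "('a, 'b) pre_digraph \<Rightarrow> 'a set set" where
  "edges G = (\<lambda>e. {tail G e, head G e}) ` arcs G"

definition vdegree :: "('a, 'b) pre_digraph \<Rightarrow> 'a \<Rightarrow> nat" where
  "vdegree G v = card {e \<in> edges G. v \<in> e}"

definition eulerian_graph :: "('a, 'b) pre_digraph \<Rightarrow> bool" where
  "eulerian_graph G \<longleftrightarrow> graph G \<and> (\<forall>v \<in> verts G. even (vdegree G v))"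

definition eulerian_digraph :: "('a, 'b) pre_digraph \<Rightarrow> bool" where
  "eulerian_digraph D \<longleftrightarrow> digraph D \<and> (\<forall>v \<in> verts D. in_degree D v = out_degree D v)"

text \<open>
  The arcs of an orientation need not have the type of the arcs of \<open>G\<close>; only their ends matter.
  Exactly one of the two possible directions of every edge is chosen.
\<close>

definition orientation :: "('a, 'c) pre_digraph \<Rightarrow> ('a, 'b) pre_digraph \<Rightarrow> bool" where
  "orientation Q G \<longleftrightarrow>
     digraph Q \<and> verts Q = verts G \<and>
     arcs_ends Q \<union> (arcs_ends Q)\<inverse> = arcs_ends G \<and>
     arcs_ends Q \<inter> (arcs_ends Q)\<inverse> = {}"

end

theory Submission
  imports Defs "HOL-Analysis.Convex" "Jordan_Normal_Form.Schur_Decomposition"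
begin

text \<open>
  Let \<open>L\<close> be the out-degree Laplacian of a digraph with \<open>n\<close> vertices, so that \<open>L 1 = 0\<close> for the
  all-ones vector \<open>1\<close>, and let \<open>N v\<close> be the number of arborescences rooted at \<open>v\<close>. Expanding
  \<open>det (L + u 1\<^sup>T)\<close> in its rows gives a matrix-tree theorem for all roots at once
  (\<open>det_laplacian_shift\<close>): this determinant equals \<open>n \<cdot> (\<Sum>v. u v \<cdot> N v)\<close>.
  
  For the constant vector \<open>u = t 1\<close> the determinant is \<open>n t\<close> times the total number of
  arborescences. On the other hand, \<open>(det M)\<^sup>2 \<le> (\<parallel>M\<parallel>\<^sup>2 / n)\<^sup>n\<close> for every real matrix \<open>M\<close> and its
  Frobenius norm, by the inequality between the arithmetic and the geometric mean for the
  eigenvalues of \<open>M\<^sup>T M\<close> (\<open>det_square_le_frobenius\<close>). The rows of \<open>L\<close> are orthogonal to \<open>1\<close>, so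
  \<open>\<parallel>L + t 1 1\<^sup>T\<parallel>\<^sup>2 = F + (n t)\<^sup>2\<close>, where \<open>F = \<parallel>L\<parallel>\<^sup>2\<close> is the sum of the squared out-degrees plus the number
  of arcs. With \<open>(n t)\<^sup>2 = F / (n - 1)\<close> one factor cancels and the claimed bound
  \<open>(\<Sum>v. N v)\<^sup>2 \<le> (F / (n - 1))\<^bsup>n - 1\<^esup>\<close> remains (\<open>sum_tree_weight_bound\<close>).
  
  For an Eulerian digraph the columns of \<open>L\<close> sum to zero as well, and then all \<open>N v\<close> are equal
  (\<open>tree_weight_balanced\<close>), so each is the \<open>n\<close>-th part of the total. In an Eulerian orientation
  the out-degrees are half the degrees of the graph, which turns \<open>F\<close> into the expression of
  the second bound.
  
  Arborescences enter only through their successor maps, and only the inequality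
  \<open>arb_le_tree_weight\<close> between the two counts is proved, which is enough for upper bounds.
\<close>

section \<open>A determinant bound from the Frobenius norm\<close>

text \<open>
  Triangularity without an ordering of the indices: if every nonzero entry off the diagonal
  leads to an index of smaller rank \<open>d\<close>, then only the identity contributes to the Leibniz sum.
  A permutation \<open>p \<noteq> id\<close> with a nonzero product would map a non-fixed point of least rank to
  another non-fixed point, of still smaller rank.
\<close>

lemma det_triangular_rank:
  fixes A :: "'a :: comm_ring_1 mat" and d :: "nat \<Rightarrow> nat"
  assumes A: "A \<in> carrier_mat n n"
    and d: "\<And>i j. i < n \<Longrightarrow> j < n \<Longrightarrow> i \<noteq> j \<Longrightarrow> A $$ (i, j) \<noteq> 0 \<Longrightarrow> d j < d i"
  shows "det A = (\<Prod>i = 0..<n. A $$ (i, i))"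
proof -
  let ?t = "\<lambda>p. signof p * (\<Prod>i = 0..<n. A $$ (i, p i))"
  have zero: "?t p = 0" if p: "p permutes {0..<n}" and "p \<noteq> id" for p
  proof (rule ccontr)
    assume "?t p \<noteq> 0"
    then have "(\<Prod>i = 0..<n. A $$ (i, p i)) \<noteq> 0" by auto
    then have nz: "A $$ (i, p i) \<noteq> 0" if "i < n" for i
      using that by (metis atLeastLessThan_iff finite_atLeastLessThan le0 prod_zero)
    obtain k where "p k \<noteq> k" using \<open>p \<noteq> id\<close> by fastforce
    define i where "i = arg_min d (\<lambda>i. p i \<noteq> i)"
    have i: "p i \<noteq> i" unfolding i_def by (rule arg_min_natI) fact
    have least: "d i \<le> d j" if "p j \<noteq> j" for j
      unfolding i_def by (rule arg_min_nat_le) fact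
    have "i < n" using i p by (meson atLeastLessThan_iff permutes_not_in le0)
    moreover have "p i < n" using \<open>i < n\<close> permutes_in_image[OF p, of i] by simp
    ultimately have "d (p i) < d i" using d[of i "p i"] i nz[of i] by auto
    moreover have "p (p i) \<noteq> p i" using i permutes_inj[OF p] by (metis injD)
    ultimately show False using least[of "p i"] by simp
  qed
  have "det A = (\<Sum>p | p permutes {0..<n}. ?t p)" by (rule det_def'[OF A])
  also have "\<dots> = (\<Sum>p\<in>{id}. ?t p)"
    by (rule sum.mono_neutral_right) (auto simp: finite_permutations permutes_id zero)
  finally show ?thesis by simp
qed

lemma trace_similar:
  fixes A :: "'a :: comm_ring_1 mat"
  assumes A: "A \<in> carrier_mat n n" and sim: "similar_mat_wit A B P Q"
  shows "(\<Sum>i<n. A $$ (i, i)) = (\<Sum>i<n. B $$ (i, i))"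
proof -
  note w = similar_mat_witD2[OF A sim]
  have comm: "(\<Sum>i<n. (X * Y) $$ (i, i)) = (\<Sum>i<n. (Y * X) $$ (i, i))"
    if X: "X \<in> carrier_mat n n" and Y: "Y \<in> carrier_mat n n" for X Y :: "'a mat"
  proof -
    have "(\<Sum>i<n. (X * Y) $$ (i, i)) = (\<Sum>i<n. \<Sum>j<n. X $$ (i, j) * Y $$ (j, i))"
      using X Y by (simp add: scalar_prod_def atLeast0LessThan)
    also have "\<dots> = (\<Sum>j<n. \<Sum>i<n. Y $$ (j, i) * X $$ (i, j))"
      by (subst sum.swap) (simp add: mult.commute)
    also have "\<dots> = (\<Sum>i<n. (Y * X) $$ (i, i))"
      using X Y by (simp add: scalar_prod_def atLeast0LessThan)
    finally show ?thesis .
  qed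
  have "(\<Sum>i<n. A $$ (i, i)) = (\<Sum>i<n. (Q * (P * B)) $$ (i, i))"
    using w comm[of "P * B" Q] by simp
  also have "Q * (P * B) = B"
    using w assoc_mult_mat[of Q n n P n B n] by simp
  finally show ?thesis .
qed

text \<open>
  If \<open>A\<^sup>T A v = k v\<close>, then \<open>k \<parallel>v\<parallel>\<^sup>2 = \<parallel>A v\<parallel>\<^sup>2\<close>; both norms are written out as sums below.
\<close>

lemma gram_eigenvalue_nonneg:
  fixes A :: "real mat"
  assumes A: "A \<in> carrier_mat n n"
    and ev: "eigenvalue (map_mat complex_of_real (A\<^sup>T * A)) k"
  shows "\<exists>x\<ge>0. k = complex_of_real x"
proof -
  let ?C = "map_mat complex_of_real (A\<^sup>T * A)"
  obtain v where v: "v \<in> carrier_vec n" "v \<noteq> 0\<^sub>v n" "?C *\<^sub>v v = k \<cdot>\<^sub>v v"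
    using ev A unfolding eigenvalue_def eigenvector_def by auto
  define w where "w = (\<lambda>i. \<Sum>j<n. of_real (A $$ (i, j)) * v $ j)"
  have Cv: "(\<Sum>i<n. of_real (A $$ (i, j)) * w i) = k * v $ j" if j: "j < n" for j
  proof -
    have "k * v $ j = (?C *\<^sub>v v) $ j" using v j by simp
    also have "\<dots> = (\<Sum>l<n. (\<Sum>i<n. of_real (A $$ (i, j)) * of_real (A $$ (i, l))) * v $ l)"
      using A v(1) j by (simp add: scalar_prod_def atLeast0LessThan)
    also have "\<dots> = (\<Sum>i<n. of_real (A $$ (i, j)) * w i)"
      unfolding w_def sum_distrib_left sum_distrib_right
      by (subst sum.swap) (simp add: mult.assoc)
    finally show ?thesis by simp
  qed
  have sq: "cnj z * z = of_real ((cmod z)\<^sup>2)" for z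
    by (metis complex_norm_square mult.commute)
  have "k * of_real (\<Sum>j<n. (cmod (v $ j))\<^sup>2) = (\<Sum>j<n. cnj (v $ j) * (k * v $ j))"
    by (simp add: sum_distrib_left sq[symmetric] algebra_simps del: of_real_power)
  also have "\<dots> = (\<Sum>j<n. cnj (v $ j) * (\<Sum>i<n. of_real (A $$ (i, j)) * w i))"
    by (simp add: Cv)
  also have "\<dots> = (\<Sum>i<n. (\<Sum>j<n. of_real (A $$ (i, j)) * cnj (v $ j)) * w i)"
    unfolding sum_distrib_left sum_distrib_right
    by (subst sum.swap) (simp add: mult_ac)
  also have "\<dots> = (\<Sum>i<n. cnj (w i) * w i)"
    by (simp add: w_def)
  finally have eq: "k * of_real (\<Sum>j<n. (cmod (v $ j))\<^sup>2) = of_real (\<Sum>i<n. (cmod (w i))\<^sup>2)"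
    by (simp add: sq)
  have "\<exists>j<n. v $ j \<noteq> 0" using v by (metis eq_vecI carrier_vecD index_zero_vec)
  then have pos: "(\<Sum>j<n. (cmod (v $ j))\<^sup>2) > 0"
    by (auto intro!: sum_pos2)
  have "k = of_real ((\<Sum>i<n. (cmod (w i))\<^sup>2) / (\<Sum>j<n. (cmod (v $ j))\<^sup>2))"
    using eq pos by (metis nonzero_eq_divide_eq of_real_divide of_real_eq_0_iff less_irrefl)
  moreover have "(\<Sum>i<n. (cmod (w i))\<^sup>2) / (\<Sum>j<n. (cmod (v $ j))\<^sup>2) \<ge> 0"
    by (intro divide_nonneg_nonneg sum_nonneg) simp_all
  ultimately show ?thesis by blast
qed

lemma arith_geom_mean_power:
  fixes x :: "nat \<Rightarrow> real"
  assumes "\<And>i. i < n \<Longrightarrow> x i \<ge> 0"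
  shows "(\<Prod>i<n. x i) \<le> ((\<Sum>i<n. x i) / real n) ^ n"
proof (cases "n = 0")
  case False
  have "((\<Prod>i<n. x i) powr (1 / real n)) ^ n \<le> ((\<Sum>i<n. x i) / real n) ^ n"
    using arith_geom_mean[of "{..<n}" x] False assms
    by (intro power_mono) (auto simp: sum_divide_distrib)
  moreover have "(p powr (1 / real n)) ^ n = p" if "p \<ge> 0" for p
    using False that by (cases "p = 0") (auto simp: powr_power)
  moreover have "(\<Prod>i<n. x i) \<ge> 0" using assms by (intro prod_nonneg) auto
  ultimately show ?thesis by simp
qed simp

text \<open>
  A weak form of Hadamard's inequality. The determinant and the trace of the Gram matrix
  \<open>A\<^sup>T A\<close> are the product and the sum of its eigenvalues, which are nonnegative reals; they equal
  \<open>(det A)\<^sup>2\<close> and the squared Frobenius norm of \<open>A\<close>, so this is the inequality between the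
  arithmetic and the geometric mean.
\<close>

lemma det_square_le_frobenius:
  fixes A :: "real mat"
  assumes A: "A \<in> carrier_mat n n"
  shows "(det A)\<^sup>2 \<le> ((\<Sum>i<n. \<Sum>j<n. (A $$ (i, j))\<^sup>2) / real n) ^ n"
proof -
  define G where "G = A\<^sup>T * A"
  have G: "G \<in> carrier_mat n n" unfolding G_def using A by simp
  let ?C = "map_mat complex_of_real G"
  have C: "?C \<in> carrier_mat n n" using G by simp
  obtain as where cp: "char_poly ?C = (\<Prod>a\<leftarrow>as. [:- a, 1:])" and len: "length as = n"
    using char_poly_factorized[OF C] by blast
  obtain B P Q where sd: "schur_decomposition ?C as = (B, P, Q)" by (metis prod_cases3)
  note S = schur_decomposition[OF C cp sd]
  have B: "B \<in> carrier_mat n n" using S similar_mat_witD2[OF C] by blast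
  have as: "as ! i = B $$ (i, i)" if "i < n" for i
    using S B that by (auto simp: diag_mat_def)
  have "\<exists>x\<ge>0. as ! i = complex_of_real x" if "i < n" for i
  proof -
    have "poly (char_poly ?C) (as ! i) = 0"
      unfolding cp using that len by (auto simp: poly_prod_list prod_list_zero_iff image_iff)
    then have "eigenvalue ?C (as ! i)" using eigenvalue_root_char_poly[OF C] by simp
    then show ?thesis using gram_eigenvalue_nonneg[OF A] unfolding G_def by blast
  qed
  then obtain x where x: "\<And>i. i < n \<Longrightarrow> x i \<ge> 0 \<and> as ! i = complex_of_real (x i)"
    by metis
  have "complex_of_real (det G) = det ?C" by (rule of_real_hom.hom_det[symmetric])
  also have "\<dots> = det B" using S det_similar unfolding similar_mat_def by blast
  also have "\<dots> = (\<Prod>i<n. as ! i)"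
    using S det_upper_triangular[OF _ B] len
    by (auto simp: prod.list_conv_set_nth atLeast0LessThan)
  also have "\<dots> = of_real (\<Prod>i<n. x i)" using x by simp
  finally have det: "det G = (\<Prod>i<n. x i)" by (metis of_real_eq_iff)
  have "complex_of_real (\<Sum>i<n. G $$ (i, i)) = (\<Sum>i<n. ?C $$ (i, i))" using G by simp
  also have "\<dots> = (\<Sum>i<n. B $$ (i, i))" using S by (intro trace_similar[OF C]) blast
  also have "\<dots> = of_real (\<Sum>i<n. x i)" using x as by simp
  finally have tr: "(\<Sum>i<n. G $$ (i, i)) = (\<Sum>i<n. x i)" by (metis of_real_eq_iff)
  have "(det A)\<^sup>2 = det G"
    unfolding G_def using A by (simp add: det_mult[of _ n] det_transpose power2_eq_square)
  also have "\<dots> \<le> ((\<Sum>i<n. G $$ (i, i)) / real n) ^ n"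
    unfolding det tr using x by (intro arith_geom_mean_power) blast
  also have "(\<Sum>i<n. G $$ (i, i)) = (\<Sum>i<n. \<Sum>j<n. (A $$ (j, i))\<^sup>2)"
    unfolding G_def using A by (simp add: scalar_prod_def power2_eq_square atLeast0LessThan)
  also have "\<dots> = (\<Sum>i<n. \<Sum>j<n. (A $$ (i, j))\<^sup>2)" by (rule sum.swap)
  finally show ?thesis .
qed

section \<open>The matrix-tree theorem\<close>

text \<open>
  An arborescence on the vertices \<open>0, \<dots>, n - 1\<close> is recorded by the map that sends every vertex
  to its successor. The extra index \<open>n\<close> is a sink: the root is sent there, and being a tree
  means that every vertex reaches the sink. Fixing all indices from \<open>n\<close> on makes the sink
  absorbing and makes the map unique; it is also the convention under which
  \<open>det_linear_rows_sum\<close> enumerates choice functions.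
\<close>

definition rooted_maps :: "nat \<Rightarrow> nat \<Rightarrow> (nat \<Rightarrow> nat) set" where
  "rooted_maps n v =
     {f. f v = n \<and> (\<forall>i<n. i \<noteq> v \<longrightarrow> f i < n) \<and> (\<forall>i\<ge>n. f i = i) \<and> (\<forall>i<n. \<exists>k. (f ^^ k) i = n)}"

text \<open>
  The rows of this matrix are the terms of the multilinear expansion of \<open>det_laplacian_shift\<close>:
  an arc from \<open>i\<close> to \<open>f i\<close> contributes the row \<open>e\<^sub>i - e\<^bsub>f i\<^esub>\<close>, the sink contributes the
  all-ones row.
\<close>

definition map_matrix :: "nat \<Rightarrow> (nat \<Rightarrow> nat) \<Rightarrow> real mat" where
  "map_matrix n f =
     mat n n (\<lambda>(i, j). if f i = n then 1 else (if j = i then 1 else 0) - (if j = f i then 1 else 0))"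

lemma map_matrix_carrier: "map_matrix n f \<in> carrier_mat n n"
  by (simp add: map_matrix_def)

text \<open>
  All rows but that of the root are orthogonal to the all-ones vector. Hence adding all columns
  to column \<open>v\<close> turns that column into \<open>n e\<^sub>v\<close>. What remains is triangular with respect to the
  distance to the sink, provided that the root, whose row has no zeros, is given a rank above
  all others.
\<close>

lemma det_map_matrix_rooted:
  assumes f: "f \<in> rooted_maps n v" and v: "v < n"
  shows "det (map_matrix n f) = real n"
proof -
  have fv: "f v = n" and fi: "\<And>i. i < n \<Longrightarrow> i \<noteq> v \<Longrightarrow> f i < n"
    and reach: "\<And>i. i < n \<Longrightarrow> \<exists>k. (f ^^ k) i = n" and fn: "f n = n"
    using f by (auto simp: rooted_maps_def)
  \<comment> \<open>the distance to the sink\<close>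
  define d where "d i = (LEAST k. (f ^^ k) i = n)" for i
  have d_less: "d (f i) < d i" if i: "i < n" for i
  proof -
    have at: "(f ^^ d i) i = n" unfolding d_def using reach[OF i] by (rule LeastI_ex)
    with i obtain k where k: "d i = Suc k" by (cases "d i") auto
    then have "(f ^^ k) (f i) = n" using at by (simp add: funpow_swap1)
    then have "d (f i) \<le> k" unfolding d_def by (rule Least_le)
    then show ?thesis using k by simp
  qed
  define e where "e i = (if i = v then Suc (\<Sum>j<n. d j) else d i)" for i
  have e_v: "e j < e v" if "j < n" "j \<noteq> v" for j
    using that member_le_sum[of j "{..<n}" d] by (auto simp: e_def)
  \<comment> \<open>right multiplication by \<open>?T\<close> adds all columns to column \<open>v\<close>\<close>
  let ?T = "mat n n (\<lambda>(i, j). if j = i \<or> j = v then 1 else 0 :: real)"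
  let ?M = "mat n n (\<lambda>(i, j). if i = v then (if j = v then real n else 1)
    else if j = v then 0 else (if j = i then 1 else 0) - (if j = f i then 1 else 0))"
  have "map_matrix n f * ?T = ?M"
  proof (rule eq_matI)
    fix i j assume "i < dim_row ?M" "j < dim_col ?M"
    then have i: "i < n" and j: "j < n" by auto
    have iv: "f i = n \<longleftrightarrow> i = v" using fi[OF i] fv by fastforce
    have "(map_matrix n f * ?T) $$ (i, j) =
      (\<Sum>k<n. (if f i = n then 1 else (if k = i then 1 else 0) - (if k = f i then 1 else 0))
        * (if j = k \<or> j = v then 1 else 0))"
      using i j by (simp add: map_matrix_def scalar_prod_def atLeast0LessThan)
    also have "\<dots> = ?M $$ (i, j)"
    proof (cases "j = v")
      case True
      then show ?thesis using i j iv fi[of i]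
        by (cases "i = v") (simp_all add: sum_subtractf)
    next
      case False
      define m where "m k = (if f i = n then 1 else (if k = i then 1 else 0) - (if k = f i then 1 else 0 :: real))" for k
      have "(\<Sum>k<n. m k * (if j = k \<or> j = v then 1 else 0)) = (\<Sum>k<n. if j = k then m k else 0)"
        using False by (intro sum.cong) auto
      also have "\<dots> = m j" using j by simp
      also have "m j = ?M $$ (i, j)" using i j False iv by (simp add: m_def)
      finally show ?thesis by (simp only: m_def)
    qed
    finally show "(map_matrix n f * ?T) $$ (i, j) = ?M $$ (i, j)" .
  qed (auto simp: map_matrix_def)
  then have "det ?M = det (map_matrix n f) * det ?T"
    using det_mult[OF map_matrix_carrier[of n f], of ?T] by simp
  moreover have "det ?T = 1"
    by (subst det_triangular_rank[where d = "\<lambda>i. if i = v then 0 else 1" and n = n])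
       (auto split: if_splits)
  moreover have "det ?M = (\<Prod>i = 0..<n. ?M $$ (i, i))"
  proof (rule det_triangular_rank[where d = e])
    fix i j assume ij: "i < n" "j < n" "i \<noteq> j" "?M $$ (i, j) \<noteq> 0"
    then show "e j < e i"
      using e_v[of j] d_less[of i] by (auto simp: e_def split: if_splits)
  qed simp
  moreover have "(\<Prod>i = 0..<n. ?M $$ (i, i)) = (\<Prod>i = 0..<n. if i = v then real n else 1)"
    using d_less by (intro prod.cong) (auto, metis less_irrefl)
  ultimately show ?thesis using v by simp
qed

text \<open>
  There are two ways to fail. If two vertices are sent to the sink, two rows coincide. Otherwise
  the set \<open>C\<close> of vertices that never reach the sink is nonempty, and it is closed under \<open>f\<close>
  and under preimages. So its indicator is orthogonal to all rows \<open>e\<^sub>i - e\<^bsub>f i\<^esub>\<close>, as are the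
  constant vectors; a combination of the two is also orthogonal to the all-ones row and lies in
  the kernel.
\<close>

lemma det_map_matrix_not_rooted:
  assumes n: "n > 0" and f_le: "\<And>i. i < n \<Longrightarrow> f i \<le> n" and f_id: "\<And>i. i \<ge> n \<Longrightarrow> f i = i"
    and not_rooted: "\<And>v. v < n \<Longrightarrow> f \<notin> rooted_maps n v"
  shows "det (map_matrix n f) = 0"
proof (cases "\<exists>v w. v < n \<and> w < n \<and> v \<noteq> w \<and> f v = n \<and> f w = n")
  case True
  then obtain v w where "v < n" "w < n" "v \<noteq> w" "f v = n" "f w = n" by blast
  then show ?thesis
    by (intro det_identical_rows[OF map_matrix_carrier, of v w])
       (auto simp: map_matrix_def)
next
  case unique: False
  define C where "C = {i. i < n \<and> (\<forall>k. (f ^^ k) i \<noteq> n)}"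
  have "C \<noteq> {}"
  proof
    assume "C = {}"
    then have reach: "\<exists>k. (f ^^ k) i = n" if "i < n" for i using that by (auto simp: C_def)
    define k where "k = (LEAST k. (f ^^ k) 0 = n)"
    have at: "(f ^^ k) 0 = n" unfolding k_def using reach[OF n] by (rule LeastI_ex)
    with n obtain l where l: "k = Suc l" by (cases k) auto
    define v where "v = (f ^^ l) 0"
    have "v \<noteq> n" using not_less_Least[of l "\<lambda>k. (f ^^ k) 0 = n"] l by (auto simp: k_def v_def)
    moreover have "f v = n" using at l by (simp add: v_def)
    ultimately have v: "v < n" using f_id[of v] by (cases "v < n") auto
    have "f i < n" if "i < n" "i \<noteq> v" for i
      using that unique v \<open>f v = n\<close> f_le[of i] by (auto simp: le_less)
    then have "f \<in> rooted_maps n v"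
      unfolding rooted_maps_def using \<open>f v = n\<close> f_id reach by auto
    then show False using not_rooted v by blast
  qed
  have closed: "i \<in> C \<longleftrightarrow> f i \<in> C" if "i < n" "f i \<noteq> n" for i
  proof -
    have "(\<forall>k. (f ^^ k) i \<noteq> n) \<longleftrightarrow> (\<forall>k. (f ^^ Suc k) i \<noteq> n)"
      using that by (metis funpow_0 less_irrefl not0_implies_Suc)
    then show ?thesis using that f_le[of i] by (auto simp: C_def funpow_swap1)
  qed
  have C_sub: "C \<subseteq> {..<n}" by (auto simp: C_def)
  \<comment> \<open>if \<open>C\<close> is everything, there is no all-ones row and the constant vector itself is in the kernel\<close>
  define y where "y i = (if C = {..<n} then 1 else (if i \<in> C then real n else 0) - real (card C))" for i
  have kernel: "map_matrix n f *\<^sub>v vec n y = 0\<^sub>v n"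
  proof (rule eq_vecI)
    fix i assume "i < dim_vec (0\<^sub>v n :: real vec)"
    then have i: "i < n" by simp
    have "(map_matrix n f *\<^sub>v vec n y) $ i =
      (\<Sum>j<n. (if f i = n then 1 else (if j = i then 1 else 0) - (if j = f i then 1 else 0)) * y j)"
      using i by (simp add: map_matrix_def scalar_prod_def atLeast0LessThan)
    also have "\<dots> = 0"
    proof (cases "f i = n")
      case True
      then have "(f ^^ 1) i = n" by simp
      then have "i \<notin> C" unfolding C_def by blast
      then have "C \<noteq> {..<n}" using i by auto
      have "(\<Sum>j<n. if j \<in> C then real n else 0) = (\<Sum>j\<in>C. real n)"
        using C_sub by (simp add: sum.inter_restrict[symmetric] Int_absorb1)
      then show ?thesis using True \<open>C \<noteq> {..<n}\<close> by (simp add: y_def sum_subtractf)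
    next
      case False
      then have "f i < n" using f_le[OF i] by simp
      have "(\<Sum>j<n. (if f i = n then 1 else (if j = i then 1 else 0) - (if j = f i then 1 else 0)) * y j)
        = (\<Sum>j<n. (if j = i then y j else 0) - (if j = f i then y j else 0))"
        using False by (intro sum.cong) auto
      also have "\<dots> = y i - y (f i)" using i \<open>f i < n\<close> by (simp add: sum_subtractf)
      also have "\<dots> = 0" using closed[OF i False] by (simp add: y_def)
      finally show ?thesis .
    qed
    finally show "(map_matrix n f *\<^sub>v vec n y) $ i = 0\<^sub>v n $ i" using i by simp
  qed (simp add: map_matrix_def)
  obtain i where i: "i \<in> C" using \<open>C \<noteq> {}\<close> by blast
  have "card C < n" if "C \<noteq> {..<n}"
    using psubset_card_mono[of "{..<n}" C] that C_sub by auto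
  then have "y i \<noteq> 0" using i by (auto simp: y_def)
  moreover have "i < n" using i C_sub by auto
  ultimately have "vec n y \<noteq> 0\<^sub>v n" by (metis index_vec index_zero_vec(1))
  then show ?thesis
    using kernel det_0_iff_vec_prod_zero[OF map_matrix_carrier[of n f]] vec_carrier by blast
qed

text \<open>
  The matrix \<open>L + u 1\<^sup>T\<close>, where \<open>L\<close> is the out-degree Laplacian of the weighted adjacency
  matrix \<open>A\<close>.
\<close>

definition laplacian_shift :: "nat \<Rightarrow> (nat \<Rightarrow> nat \<Rightarrow> real) \<Rightarrow> (nat \<Rightarrow> real) \<Rightarrow> real mat" where
  "laplacian_shift n A u =
     mat n n (\<lambda>(i, j). (if i = j then (\<Sum>k<n. A i k) else 0) - A i j + u i)"

definition tree_weight :: "nat \<Rightarrow> (nat \<Rightarrow> nat \<Rightarrow> real) \<Rightarrow> nat \<Rightarrow> real" where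
  "tree_weight n A v = (\<Sum>f\<in>rooted_maps n v. \<Prod>i\<in>{..<n} - {v}. A i (f i))"

lemma rooted_maps_subset:
  "rooted_maps n v \<subseteq> {f. (\<forall>i\<in>{0..<n}. f i \<in> {0..n}) \<and> (\<forall>i. i \<notin> {0..<n} \<longrightarrow> f i = i)}"
proof
  fix f assume "f \<in> rooted_maps n v"
  then have "f v = n" "i < n \<Longrightarrow> i \<noteq> v \<Longrightarrow> f i < n" "n \<le> i \<Longrightarrow> f i = i" for i
    unfolding rooted_maps_def by blast+
  moreover from this have "f i \<le> n" if "i < n" for i
    using that by (cases "i = v") (simp_all add: less_imp_le)
  ultimately show "f \<in> {f. (\<forall>i\<in>{0..<n}. f i \<in> {0..n}) \<and> (\<forall>i. i \<notin> {0..<n} \<longrightarrow> f i = i)}"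
    by simp
qed

lemma finite_rooted_maps: "finite (rooted_maps n v)"
  by (rule finite_subset[OF rooted_maps_subset]) (rule finite_bounded_functions, simp_all)

text \<open>
  The matrix-tree theorem for all roots at once. Row \<open>i\<close> of \<open>L + u 1\<^sup>T\<close> is the sum of the
  vectors \<open>A i k \<cdot> (e\<^sub>i - e\<^sub>k)\<close> over \<open>k < n\<close> and of \<open>u i\<close> times the all-ones vector. Expanding the
  determinant in all rows gives a sum over maps, in which exactly the rooted maps survive,
  each with the factor \<open>n\<close>.
\<close>

lemma det_laplacian_shift:
  assumes n: "n > 0"
  shows "det (laplacian_shift n A u) = real n * (\<Sum>v<n. u v * tree_weight n A v)"
proof -
  let ?S = "{0..n}"
  let ?F = "{f. (\<forall>i\<in>{0..<n}. f i \<in> ?S) \<and> (\<forall>i. i \<notin> {0..<n} \<longrightarrow> f i = i)}"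
  define c where "c i k = (if k = n then u i else A i k)" for i k
  define r where "r i k = vec n (\<lambda>j. if k = n then 1 else (if j = i then 1 else 0) - (if j = k then 1 else 0) :: real)"
    for i k
  let ?a = "\<lambda>i k. c i k \<cdot>\<^sub>v r i k"
  have a: "?a \<in> {0..<n} \<rightarrow> ?S \<rightarrow> carrier_vec n" by (auto simp: r_def)
  have S: "?S = insert n {..<n}" by auto
  have "laplacian_shift n A u = mat\<^sub>r n n (\<lambda>i. finsum_vec TYPE(real) n (?a i) ?S)"
  proof (rule eq_matI)
    fix i j assume "i < dim_row (mat\<^sub>r n n (\<lambda>i. finsum_vec TYPE(real) n (?a i) ?S))"
      "j < dim_col (mat\<^sub>r n n (\<lambda>i. finsum_vec TYPE(real) n (?a i) ?S))"
    then have i: "i < n" and j: "j < n" by auto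
    have "mat\<^sub>r n n (\<lambda>i. finsum_vec TYPE(real) n (?a i) ?S) $$ (i, j) = (\<Sum>k\<in>?S. ?a i k $ j)"
      using i j a index_finsum_vec[of ?S j n "?a i"] by (simp add: Pi_iff)
    also have "\<dots> = u i + (\<Sum>k<n. A i k * ((if j = i then 1 else 0) - (if j = k then 1 else 0)))"
      unfolding S using j by (simp add: c_def r_def)
    also have "(\<Sum>k<n. A i k * ((if j = i then 1 else 0) - (if j = k then 1 else 0)))
      = (\<Sum>k<n. (if j = i then A i k else 0) - (if j = k then A i k else 0))"
      by (intro sum.cong) auto
    also have "u i + \<dots> = laplacian_shift n A u $$ (i, j)"
      using i j by (simp add: laplacian_shift_def sum_subtractf)
    finally show "laplacian_shift n A u $$ (i, j) =
      mat\<^sub>r n n (\<lambda>i. finsum_vec TYPE(real) n (?a i) ?S) $$ (i, j)" by simp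
  qed (auto simp: laplacian_shift_def)
  then have "det (laplacian_shift n A u) = (\<Sum>f\<in>?F. det (mat\<^sub>r n n (\<lambda>i. ?a i (f i))))"
    by (simp add: det_linear_rows_sum[OF _ a])
  also have "\<dots> = (\<Sum>f\<in>?F. (\<Prod>i = 0..<n. c i (f i)) * det (map_matrix n f))"
  proof (rule sum.cong)
    fix f
    have "mat\<^sub>r n n (\<lambda>i. r i (f i)) = map_matrix n f"
      by (rule eq_matI) (auto simp: map_matrix_def r_def)
    then show "det (mat\<^sub>r n n (\<lambda>i. ?a i (f i))) = (\<Prod>i = 0..<n. c i (f i)) * det (map_matrix n f)"
      by (subst det_rows_mul) (auto simp: r_def)
  qed simp
  also have "\<dots> = (\<Sum>f\<in>(\<Union>v<n. rooted_maps n v). (\<Prod>i = 0..<n. c i (f i)) * det (map_matrix n f))"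
  proof (rule sum.mono_neutral_right)
    show "finite ?F" by (rule finite_bounded_functions) auto
    show "(\<Union>v<n. rooted_maps n v) \<subseteq> ?F"
      by (intro UN_least rooted_maps_subset)
    show "\<forall>f\<in>?F - (\<Union>v<n. rooted_maps n v). (\<Prod>i = 0..<n. c i (f i)) * det (map_matrix n f) = 0"
      using n by (auto intro!: det_map_matrix_not_rooted)
  qed
  also have "\<dots> = (\<Sum>v<n. \<Sum>f\<in>rooted_maps n v. (\<Prod>i = 0..<n. c i (f i)) * det (map_matrix n f))"
  proof (rule sum.UNION_disjoint)
    have "v = w" if "v < n" "f \<in> rooted_maps n v" "f \<in> rooted_maps n w" for f v w
      using that unfolding rooted_maps_def mem_Collect_eq by (metis less_irrefl)
    then show "\<forall>v\<in>{..<n}. \<forall>w\<in>{..<n}. v \<noteq> w \<longrightarrow> rooted_maps n v \<inter> rooted_maps n w = {}"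
      by blast
  qed (simp_all add: finite_rooted_maps)
  also have "\<dots> = (\<Sum>v<n. \<Sum>f\<in>rooted_maps n v. real n * (u v * (\<Prod>i\<in>{..<n} - {v}. A i (f i))))"
  proof (intro sum.cong refl)
    fix v f assume v: "v \<in> {..<n}" and f: "f \<in> rooted_maps n v"
    have "(\<Prod>i = 0..<n. c i (f i)) = c v (f v) * (\<Prod>i\<in>{..<n} - {v}. c i (f i))"
      using v by (simp add: atLeast0LessThan prod.remove)
    also have "(\<Prod>i\<in>{..<n} - {v}. c i (f i)) = (\<Prod>i\<in>{..<n} - {v}. A i (f i))"
      using f by (intro prod.cong) (auto simp: c_def rooted_maps_def)
    also have "c v (f v) = u v" using f by (simp add: c_def rooted_maps_def)
    finally show "(\<Prod>i = 0..<n. c i (f i)) * det (map_matrix n f)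
      = real n * (u v * (\<Prod>i\<in>{..<n} - {v}. A i (f i)))"
      using det_map_matrix_rooted[OF f] v by simp
  qed
  also have "\<dots> = real n * (\<Sum>v<n. u v * tree_weight n A v)"
    by (simp add: tree_weight_def sum_distrib_left)
  finally show ?thesis .
qed

section \<open>Bounding and comparing tree weights\<close>

lemma tree_weight_nonneg:
  assumes "\<And>i j. A i j \<ge> 0" shows "tree_weight n A v \<ge> 0"
  unfolding tree_weight_def using assms by (intro sum_nonneg prod_nonneg) auto

lemma laplacian_shift_carrier: "laplacian_shift n A u \<in> carrier_mat n n"
  by (simp add: laplacian_shift_def)

text \<open>
  The rows of \<open>L\<close> are orthogonal to the all-ones vector, so the mixed terms cancel.
\<close>

lemma frobenius_laplacian_shift:
  assumes diag: "\<And>i. i < n \<Longrightarrow> A i i = 0"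
  shows "(\<Sum>i<n. \<Sum>j<n. (laplacian_shift n A (\<lambda>_. t) $$ (i, j))\<^sup>2) =
    (\<Sum>i<n. (\<Sum>k<n. A i k)\<^sup>2 + (\<Sum>k<n. (A i k)\<^sup>2)) + (real n * t)\<^sup>2"
proof -
  have "(\<Sum>j<n. (laplacian_shift n A (\<lambda>_. t) $$ (i, j))\<^sup>2) =
    (\<Sum>k<n. A i k)\<^sup>2 + (\<Sum>k<n. (A i k)\<^sup>2) + real n * t\<^sup>2" if i: "i < n" for i
  proof -
    let ?d = "\<Sum>k<n. A i k"
    have "(\<Sum>j<n. (laplacian_shift n A (\<lambda>_. t) $$ (i, j))\<^sup>2) =
      (\<Sum>j<n. (if i = j then ?d\<^sup>2 + 2 * t * ?d else 0) + (A i j)\<^sup>2 - 2 * t * A i j + t\<^sup>2)"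
      using i diag[OF i]
      by (intro sum.cong) (auto simp: laplacian_shift_def power2_eq_square algebra_simps)
    also have "\<dots> = ?d\<^sup>2 + 2 * t * ?d + (\<Sum>k<n. (A i k)\<^sup>2) - 2 * t * ?d + real n * t\<^sup>2"
      using i by (simp add: sum.distrib sum_subtractf sum_distrib_left)
    finally show ?thesis by simp
  qed
  then show ?thesis by (simp add: sum.distrib power2_eq_square algebra_simps)
qed

text \<open>
  The matrix \<open>L + t 1 1\<^sup>T\<close> has determinant \<open>n t\<close> times the sum of the tree weights and squared
  Frobenius norm \<open>F + (n t)\<^sup>2\<close>; a suitable \<open>t\<close> makes \<open>det_square_le_frobenius\<close> give the bound.
  If \<open>F = 0\<close>, the choice made below would be \<open>t = 0\<close> and give nothing, but then \<open>A\<close> vanishes.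
\<close>

lemma sum_tree_weight_bound:
  assumes n: "n \<ge> 2" and diag: "\<And>i. i < n \<Longrightarrow> A i i = 0"
    and F: "F = (\<Sum>i<n. (\<Sum>k<n. A i k)\<^sup>2 + (\<Sum>k<n. (A i k)\<^sup>2))"
  shows "(\<Sum>v<n. tree_weight n A v)\<^sup>2 \<le> (F / (real n - 1)) ^ (n - 1)"
proof -
  let ?W = "\<Sum>v<n. tree_weight n A v"
  have F0: "F \<ge> 0" unfolding F by (intro sum_nonneg add_nonneg_nonneg) auto
  show ?thesis
  proof (cases "F = 0")
    case True
    have A0: "A i k = 0" if "i < n" "k < n" for i k
    proof -
      have "(\<Sum>k<n. A i k)\<^sup>2 + (\<Sum>k<n. (A i k)\<^sup>2) = 0"
        using True that unfolding F
        by (subst (asm) sum_nonneg_eq_0_iff) (auto intro!: add_nonneg_nonneg sum_nonneg)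
      then have "(\<Sum>k<n. (A i k)\<^sup>2) = 0"
        by (smt (verit) sum_nonneg zero_le_power2)
      then show ?thesis using that by (simp add: sum_nonneg_eq_0_iff)
    qed
    have "tree_weight n A v = 0" for v
      unfolding tree_weight_def
    proof (rule sum.neutral, rule ballI)
      fix f assume f: "f \<in> rooted_maps n v"
      obtain i where i: "i < n" "i \<noteq> v" using n by (metis One_nat_def Suc_1 Suc_le_eq lessI less_trans zero_neq_one)
      then have "f i < n" using f unfolding rooted_maps_def by blast
      then show "(\<Prod>i\<in>{..<n} - {v}. A i (f i)) = 0"
        using i A0 by (intro prod_zero) auto
    qed
    then show ?thesis using F0 n by simp
  next
    case False
    \<comment> \<open>among all \<open>s = (n t)\<^sup>2\<close>, the value \<open>F / (n - 1)\<close> minimises the resulting bound \<open>((F + s) / n)\<^sup>n / s\<close>\<close>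
    define t where "t = sqrt (F / (real n - 1)) / real n"
    have t: "(real n * t)\<^sup>2 = F / (real n - 1)" using n F0 by (simp add: t_def)
    have "(real n * t)\<^sup>2 * ?W\<^sup>2 = (det (laplacian_shift n A (\<lambda>_. t)))\<^sup>2"
      using n by (simp add: det_laplacian_shift sum_distrib_left[symmetric] power_mult_distrib)
    also have "\<dots> \<le> ((F + (real n * t)\<^sup>2) / real n) ^ n"
      using det_square_le_frobenius[OF laplacian_shift_carrier[of n A "\<lambda>_. t"]]
        frobenius_laplacian_shift[of n A t, OF diag] unfolding F by simp
    also have "(F + (real n * t)\<^sup>2) / real n = F / (real n - 1)"
      unfolding t using n by (simp add: field_simps)
    also have "(F / (real n - 1)) ^ n = F / (real n - 1) * (F / (real n - 1)) ^ (n - 1)"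
      using n by (metis not_numeral_le_zero power_eq_if)
    finally have "F / (real n - 1) * ?W\<^sup>2 \<le> F / (real n - 1) * (F / (real n - 1)) ^ (n - 1)"
      unfolding t .
    moreover have "F / (real n - 1) > 0" using n F0 False by simp
    ultimately show ?thesis by (simp only: mult_le_cancel_left_pos)
  qed
qed

text \<open>
  The matrix \<open>I + x 1\<^sup>T\<close>; it is a shear when the entries of \<open>x\<close> sum to zero.
\<close>

definition shear :: "nat \<Rightarrow> (nat \<Rightarrow> real) \<Rightarrow> real mat" where
  "shear n x = mat n n (\<lambda>(i, j). (if i = j then 1 else 0) + x i)"

lemma shear_mult:
  assumes M: "M \<in> carrier_mat n n" and col: "\<And>j. j < n \<Longrightarrow> (\<Sum>i<n. M $$ (i, j)) = s"
  shows "shear n x * M = mat n n (\<lambda>(i, j). M $$ (i, j) + s * x i)"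
proof (rule eq_matI)
  fix i j assume "i < dim_row (mat n n (\<lambda>(i, j). M $$ (i, j) + s * x i))"
    "j < dim_col (mat n n (\<lambda>(i, j). M $$ (i, j) + s * x i))"
  then have i: "i < n" and j: "j < n" by auto
  have "(shear n x * M) $$ (i, j) = (\<Sum>k<n. ((if i = k then 1 else 0) + x i) * M $$ (k, j))"
    using i j M by (simp add: shear_def scalar_prod_def atLeast0LessThan)
  also have "\<dots> = (\<Sum>k<n. (if i = k then M $$ (k, j) else 0) + x i * M $$ (k, j))"
    by (intro sum.cong) (auto simp: algebra_simps)
  also have "\<dots> = M $$ (i, j) + x i * s"
    using i by (simp add: sum.distrib sum_distrib_left[symmetric] col[OF j])
  finally show "(shear n x * M) $$ (i, j) = mat n n (\<lambda>(i, j). M $$ (i, j) + s * x i) $$ (i, j)"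
    using i j by (simp add: mult.commute)
qed (use M in \<open>auto simp: shear_def\<close>)

text \<open>
  A shear is the square of the shear by half the vector.
\<close>

lemma det_shear_nonneg:
  assumes x: "(\<Sum>i<n. x i) = 0"
  shows "det (shear n x) \<ge> 0"
proof -
  let ?y = "\<lambda>i. x i / 2"
  have y: "shear n ?y \<in> carrier_mat n n" by (simp add: shear_def)
  have "(\<Sum>i<n. shear n ?y $$ (i, j)) = 1" if "j < n" for j
    using that x by (simp add: shear_def sum.distrib sum_divide_distrib[symmetric])
  then have "shear n ?y * shear n ?y = mat n n (\<lambda>(i, j). shear n ?y $$ (i, j) + 1 * ?y i)"
    by (rule shear_mult[OF y])
  also have "\<dots> = shear n x" by (rule eq_matI) (auto simp: shear_def)
  finally have "det (shear n x) = det (shear n ?y) * det (shear n ?y)"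
    using det_mult[OF y y] by simp
  then show ?thesis by simp
qed

text \<open>
  In the balanced case the columns of \<open>L\<close> also sum to zero, so the shear along
  \<open>x = c (e\<^sub>w - e\<^sub>v)\<close> fixes \<open>L\<close> and maps \<open>L + e\<^sub>v 1\<^sup>T\<close> to \<open>L + (e\<^sub>v + x) 1\<^sup>T\<close>. By the matrix-tree
  theorem the determinants are \<open>n W v\<close> and \<open>n (W v + c (W w - W v))\<close> for the tree weights \<open>W\<close>.
  The second is thus nonnegative for every real \<open>c\<close>, which forces the slope \<open>W w - W v\<close> to be zero.
\<close>

lemma tree_weight_balanced:
  assumes A: "\<And>i j. A i j \<ge> 0"
    and balanced: "\<And>j. j < n \<Longrightarrow> (\<Sum>i<n. A i j) = (\<Sum>k<n. A j k)"
    and v: "v < n" and w: "w < n"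
  shows "tree_weight n A v = tree_weight n A w"
proof (rule ccontr)
  let ?W = "tree_weight n A"
  assume neq: "?W v \<noteq> ?W w"
  \<comment> \<open>the slope being nonzero, this \<open>c\<close> brings \<open>W v + c (W w - W v)\<close> to \<open>-1\<close>\<close>
  define c where "c = - (?W v + 1) / (?W w - ?W v)"
  define u where "u i = (if i = v then 1 else 0 :: real)" for i
  define x where "x i = c * ((if i = w then 1 else 0) - (if i = v then 1 else 0))" for i
  have sum_u: "(\<Sum>i<n. u i) = 1" using v by (simp add: u_def)
  have sum_x: "(\<Sum>i<n. x i) = 0"
    using v w by (simp add: x_def sum_distrib_left[symmetric] sum_subtractf)
  have "(\<Sum>i<n. laplacian_shift n A u $$ (i, j)) = 1" if j: "j < n" for j
    using j sum_u balanced[OF j] by (simp add: laplacian_shift_def sum.distrib sum_subtractf)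
  then have "shear n x * laplacian_shift n A u
      = mat n n (\<lambda>(i, j). laplacian_shift n A u $$ (i, j) + 1 * x i)"
    by (rule shear_mult[OF laplacian_shift_carrier])
  also have "\<dots> = laplacian_shift n A (\<lambda>i. u i + x i)"
    by (rule eq_matI) (auto simp: laplacian_shift_def)
  finally have "det (laplacian_shift n A (\<lambda>i. u i + x i)) = det (shear n x) * det (laplacian_shift n A u)"
    using det_mult[of "shear n x" n "laplacian_shift n A u"]
    by (simp add: laplacian_shift_carrier) (simp add: shear_def)
  moreover have "n > 0" using v by simp
  ultimately have eq: "real n * (\<Sum>i<n. (u i + x i) * ?W i) = det (shear n x) * (real n * (\<Sum>i<n. u i * ?W i))"
    by (simp add: det_laplacian_shift)
  have "(\<Sum>i<n. u i * ?W i) = (\<Sum>i<n. if i = v then ?W i else 0)"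
    by (intro sum.cong) (auto simp: u_def)
  also have "\<dots> = ?W v" using v by simp
  finally have uW: "(\<Sum>i<n. u i * ?W i) = ?W v" .
  have "(\<Sum>i<n. x i * ?W i) = (\<Sum>i<n. (if i = w then c * ?W i else 0) - (if i = v then c * ?W i else 0))"
    by (intro sum.cong) (auto simp: x_def)
  also have "\<dots> = c * (?W w - ?W v)" using v w by (simp add: sum_subtractf algebra_simps)
  also have "\<dots> = - (?W v + 1)" using neq by (simp add: c_def)
  finally have "(\<Sum>i<n. (u i + x i) * ?W i) = - 1"
    using uW by (simp add: distrib_right sum.distrib)
  then have "- real n = det (shear n x) * (real n * ?W v)" using eq uW by simp
  moreover have "det (shear n x) * (real n * ?W v) \<ge> 0"
    using det_shear_nonneg[OF sum_x] tree_weight_nonneg[OF A] by (intro mult_nonneg_nonneg) auto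
  ultimately show False using \<open>n > 0\<close> by simp
qed

section \<open>Arborescences of digraphs\<close>

definition adjacency :: "('a, 'b) pre_digraph \<Rightarrow> (nat \<Rightarrow> 'a) \<Rightarrow> nat \<Rightarrow> nat \<Rightarrow> real" where
  "adjacency D h i j = (if (h i, h j) \<in> arcs_ends D then 1 else 0)"

lemma card_out_neighbours:
  assumes "digraph D"
  shows "out_degree D u = card {w. (u, w) \<in> arcs_ends D}"
proof -
  interpret digraph D by fact
  have "{w. (u, w) \<in> arcs_ends D} = head D ` out_arcs D u"
    by (auto simp: arcs_ends_conv out_arcs_def)
  moreover have "inj_on (head D) (out_arcs D u)"
    by (rule inj_onI, rule no_multi_arcs) (auto simp: out_arcs_def arc_to_ends_def)
  ultimately show ?thesis by (simp add: out_degree_def card_image)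
qed

lemma card_in_neighbours:
  assumes "digraph D"
  shows "in_degree D u = card {w. (w, u) \<in> arcs_ends D}"
proof -
  interpret digraph D by fact
  have "{w. (w, u) \<in> arcs_ends D} = tail D ` in_arcs D u"
    by (auto simp: arcs_ends_conv in_arcs_def)
  moreover have "inj_on (tail D) (in_arcs D u)"
    by (rule inj_onI, rule no_multi_arcs) (auto simp: in_arcs_def arc_to_ends_def)
  ultimately show ?thesis by (simp add: in_degree_def card_image)
qed

lemma sum_indicator_bij:
  fixes h :: "nat \<Rightarrow> 'a"
  assumes h: "bij_betw h {..<n} V" and S: "S \<subseteq> V"
  shows "(\<Sum>i<n. if h i \<in> S then 1 else 0 :: real) = real (card S)"
proof -
  have "(\<Sum>i<n. if h i \<in> S then 1 else 0 :: real) = (\<Sum>w\<in>V. if w \<in> S then 1 else 0)"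
    by (rule sum.reindex_bij_betw[OF h])
  also have "\<dots> = real (card S)"
    using S bij_betw_finite[OF h]
    by (subst sum.mono_neutral_cong_right[where S = S and h = "\<lambda>_. 1"]) auto
  finally show ?thesis .
qed

lemma
  assumes D: "digraph D" and h: "bij_betw h {..<n} (verts D)"
  shows adjacency_row_sum: "(\<Sum>k<n. adjacency D h i k) = real (out_degree D (h i))"
    and adjacency_column_sum: "(\<Sum>k<n. adjacency D h k i) = real (in_degree D (h i))"
proof -
  interpret digraph D by fact
  have "{w. (h i, w) \<in> arcs_ends D} \<subseteq> verts D" "{w. (w, h i) \<in> arcs_ends D} \<subseteq> verts D"
    by (auto simp: arcs_ends_conv)
  from this[THEN sum_indicator_bij[OF h]]
  show "(\<Sum>k<n. adjacency D h i k) = real (out_degree D (h i))"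
    "(\<Sum>k<n. adjacency D h k i) = real (in_degree D (h i))"
    by (simp_all add: adjacency_def card_out_neighbours[OF D] card_in_neighbours[OF D])
qed

lemma sum_out_degree:
  assumes "digraph D"
  shows "(\<Sum>u\<in>verts D. out_degree D u) = card (arcs D)"
proof -
  interpret digraph D by fact
  have "(\<Sum>u\<in>verts D. \<Sum>e\<in>{e \<in> arcs D. tail D e = u}. 1 :: nat) = (\<Sum>e\<in>arcs D. 1)"
    by (rule sum.group) auto
  then show ?thesis by (simp add: out_degree_def out_arcs_def)
qed

text \<open>
  The map of heads of out-arcs in \<open>T\<close>, transported to indices along the numbering \<open>h\<close> of the
  vertices.
\<close>

definition successor_map ::
    "('a, 'b) pre_digraph \<Rightarrow> (nat \<Rightarrow> 'a) \<Rightarrow> nat \<Rightarrow> nat \<Rightarrow> ('a, 'b) pre_digraph \<Rightarrow> nat \<Rightarrow> nat" where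
  "successor_map D h n v T i =
     (if i = v then n
      else if i < n then the_inv_into {..<n} h (head D (THE e. e \<in> out_arcs T (h i)))
      else i)"

context
  fixes D :: "('a, 'b) pre_digraph" and h :: "nat \<Rightarrow> 'a" and n v :: nat
  assumes D: "digraph D" and h: "bij_betw h {..<n} (verts D)" and v: "v < n"
begin

text \<open>
  As the digraph has no parallel arcs, the arcs of an arborescence are recovered from its
  successor map; this gives the injectivity in \<open>arb_le_tree_weight\<close>.
\<close>

lemma arborescence_arcs:
  assumes T: "arborescence D (h v) T"
  shows "e \<in> arcs T \<longleftrightarrow> e \<in> arcs D \<and>
    (\<exists>i<n. i \<noteq> v \<and> tail D e = h i \<and> head D e = h (successor_map D h n v T i) \<and> successor_map D h n v T i < n)"
proof -
  interpret digraph D by (rule D)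
  have sub: "arcs T \<subseteq> arcs D" and tail: "tail T = tail D"
    using T by (auto simp: arborescence_def spanning_def subgraph_def compatible_def)
  have inj: "inj_on h {..<n}" and im: "h ` {..<n} = verts D" using h by (auto simp: bij_betw_def)
  have root: "out_arcs T (h v) = {}"
    using T finite_subset[OF sub finite_arcs]
    by (auto simp: arborescence_def out_degree_def out_arcs_def)
  have hj: "h i \<in> verts D" if "i < n" for i using that im by blast
  have unique: "\<exists>!e. e \<in> out_arcs T (h i)" if i: "i < n" "i \<noteq> v" for i
  proof -
    have "h i \<noteq> h v" using i v inj by (auto dest: inj_onD)
    then have "card (out_arcs T (h i)) = 1"
      using T hj[OF i(1)] by (auto simp: arborescence_def out_degree_def)
    then obtain e where "out_arcs T (h i) = {e}" by (rule card_1_singletonE)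
    then show ?thesis by (metis insert_iff empty_iff)
  qed
  have succ: "\<exists>e\<in>arcs T. tail D e = h i \<and> head D e = h (successor_map D h n v T i) \<and>
      successor_map D h n v T i < n \<and> (\<forall>e'\<in>arcs T. tail D e' = h i \<longrightarrow> e' = e)"
    if i: "i < n" "i \<noteq> v" for i
  proof -
    let ?e = "THE e. e \<in> out_arcs T (h i)"
    have e: "?e \<in> out_arcs T (h i)" using unique[OF i] by (rule theI')
    then have "head D ?e \<in> h ` {..<n}" unfolding im using sub by (auto simp: out_arcs_def)
    then have "h (successor_map D h n v T i) = head D ?e" "successor_map D h n v T i < n"
      using i f_the_inv_into_f[OF inj] the_inv_into_into[OF inj, of "head D ?e" "{..<n}"]
      by (simp_all add: successor_map_def)
    then show ?thesis using e unique[OF i] by (auto simp: out_arcs_def tail)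
  qed
  show ?thesis
  proof
    assume e: "e \<in> arcs T"
    then have "tail D e \<in> h ` {..<n}" unfolding im using sub by auto
    then obtain i where i: "i < n" "tail D e = h i" by auto
    have "i \<noteq> v" using i e root by (auto simp: out_arcs_def tail)
    then show "e \<in> arcs D \<and> (\<exists>i<n. i \<noteq> v \<and> tail D e = h i \<and>
        head D e = h (successor_map D h n v T i) \<and> successor_map D h n v T i < n)"
      using succ[OF i(1)] i e sub by blast
  next
    assume r: "e \<in> arcs D \<and> (\<exists>i<n. i \<noteq> v \<and> tail D e = h i \<and>
        head D e = h (successor_map D h n v T i) \<and> successor_map D h n v T i < n)"
    then obtain i where i: "i < n" "i \<noteq> v" "tail D e = h i" "head D e = h (successor_map D h n v T i)"
      by blast
    obtain e' where e': "e' \<in> arcs T" "tail D e' = h i" "head D e' = h (successor_map D h n v T i)"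
      using succ[OF i(1,2)] by blast
    have "e = e'" using r i e' sub by (intro no_multi_arcs) (auto simp: arc_to_ends_def)
    then show "e \<in> arcs T" using e' by simp
  qed
qed

lemma successor_map_arc:
  assumes T: "arborescence D (h v) T" and i: "i < n" "i \<noteq> v"
  shows "successor_map D h n v T i < n" "(h i, h (successor_map D h n v T i)) \<in> arcs_ends D"
proof -
  interpret digraph D by (rule D)
  have sub: "arcs T \<subseteq> arcs D" and tail: "tail T = tail D"
    using T by (auto simp: arborescence_def spanning_def subgraph_def compatible_def)
  have inj: "inj_on h {..<n}" and im: "h ` {..<n} = verts D" using h by (auto simp: bij_betw_def)
  have "h i \<noteq> h v" using i v inj by (auto dest: inj_onD)
  then have "out_degree T (h i) = 1"
    using T i im by (auto simp: arborescence_def)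
  then have "out_arcs T (h i) \<noteq> {}" by (auto simp: out_degree_def)
  then obtain e where e: "e \<in> arcs T" "tail D e = h i" by (auto simp: out_arcs_def tail)
  then obtain j where j: "j < n" "tail D e = h j" "head D e = h (successor_map D h n v T j)"
    "successor_map D h n v T j < n" "e \<in> arcs D"
    using arborescence_arcs[OF T, of e] by blast
  have "j = i" using j e i inj by (auto dest: inj_onD)
  then show "successor_map D h n v T i < n" "(h i, h (successor_map D h n v T i)) \<in> arcs_ends D"
    using j by (auto simp: arcs_ends_conv image_iff intro!: bexI[of _ e])
qed

text \<open>
  Reaching the sink is invariant along the arcs of \<open>T\<close> in both directions, because every arc
  joins some \<open>i\<close> to its successor. Since \<open>T\<close> is connected and the root reaches the sink, all
  vertices do.
\<close>

lemma successor_map_rooted: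
  assumes T: "arborescence D (h v) T"
  shows "successor_map D h n v T \<in> rooted_maps n v"
proof -
  interpret digraph D by (rule D)
  let ?f = "successor_map D h n v T"
  have tail: "tail T = tail D" and head: "head T = head D" and vT: "verts T = verts D"
    using T by (auto simp: arborescence_def spanning_def subgraph_def compatible_def)
  have inj: "inj_on h {..<n}" and im: "h ` {..<n} = verts D" using h by (auto simp: bij_betw_def)
  define R where "R u \<longleftrightarrow> (\<exists>i<n. u = h i \<and> (\<exists>k. (?f ^^ k) i = n))" for u
  have R_iff: "R (h i) \<longleftrightarrow> (\<exists>k. (?f ^^ k) i = n)" if "i < n" for i
    using that inj by (auto simp: R_def dest: inj_onD)
  have step: "R (h i) \<longleftrightarrow> R (h (?f i))" if i: "i < n" "?f i < n" for i
  proof -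
    have "(\<exists>k. (?f ^^ k) i = n) \<longleftrightarrow> (\<exists>k. (?f ^^ Suc k) i = n)"
      using i by (metis funpow_0 less_irrefl not0_implies_Suc)
    then show ?thesis using i by (simp add: R_iff funpow_swap1)
  qed
  have edge: "R a" if arc: "(a, b) \<in> parcs (mk_symmetric T)" and b: "R b" for a b
  proof -
    obtain e where e: "e \<in> arcs T" and ab: "(a, b) = (tail D e, head D e) \<or> (a, b) = (head D e, tail D e)"
      using arc by (auto simp: mk_symmetric_def tail head)
    obtain i where "i < n" "tail D e = h i" "head D e = h (?f i)" "?f i < n"
      using arborescence_arcs[OF T, of e] e by blast
    then show ?thesis using ab step[of i] b by auto
  qed
  have R_root: "R (h v)"
    unfolding R_iff[OF v] by (rule exI[of _ 1]) (simp add: successor_map_def)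
  have "R u" if u: "u \<in> verts D" for u
  proof -
    have "u \<rightarrow>\<^sup>*\<^bsub>with_proj (mk_symmetric T)\<^esub> h v"
      using T u im v unfolding arborescence_def underlying_tree_def connected_def strongly_connected_def
      by (auto simp: mk_symmetric_def vT)
    then have "(u, h v) \<in> (parcs (mk_symmetric T))\<^sup>*"
      unfolding reachable_def by (auto dest: rtrancl_on_rtranclI)
    then show ?thesis
      by (induction rule: converse_rtrancl_induct) (auto intro: R_root edge)
  qed
  then have "\<exists>k. (?f ^^ k) i = n" if "i < n" for i
    using that im R_iff by blast
  then show ?thesis
    using successor_map_arc(1)[OF T] v by (auto simp: rooted_maps_def successor_map_def)
qed

lemma arb_le_tree_weight: "real (arb D (h v)) \<le> tree_weight n (adjacency D h) v"
proof -
  interpret digraph D by (rule D)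
  let ?R = "{f \<in> rooted_maps n v. \<forall>i\<in>{..<n} - {v}. (h i, h (f i)) \<in> arcs_ends D}"
  have fin: "finite ?R" by (rule finite_subset[OF _ finite_rooted_maps[of n v]]) blast
  have "inj_on (successor_map D h n v) {T. arborescence D (h v) T}"
  proof (rule inj_onI)
    fix T T' assume T: "T \<in> {T. arborescence D (h v) T}" "T' \<in> {T. arborescence D (h v) T}"
      and eq: "successor_map D h n v T = successor_map D h n v T'"
    then have "arcs T = arcs T'" using arborescence_arcs[of T] arborescence_arcs[of T'] by auto
    moreover have "verts T = verts T'" "tail T = tail T'" "head T = head T'"
      using T by (auto simp: arborescence_def spanning_def subgraph_def compatible_def)
    ultimately show "T = T'" by simp
  qed
  moreover have "successor_map D h n v ` {T. arborescence D (h v) T} \<subseteq> ?R"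
    using successor_map_rooted successor_map_arc(2) by auto
  ultimately have "arb D (h v) \<le> card ?R"
    unfolding arb_def by (rule card_inj_on_le[OF _ _ fin])
  also have "real (card ?R) = (\<Sum>f\<in>rooted_maps n v. if \<forall>i\<in>{..<n} - {v}. (h i, h (f i)) \<in> arcs_ends D then 1 else 0)"
    by (simp add: sum.If_cases finite_rooted_maps Int_def)
  also have "\<dots> = tree_weight n (adjacency D h) v"
    unfolding tree_weight_def
    by (intro sum.cong refl) (auto simp: adjacency_def intro!: prod_zero[symmetric] prod.neutral[symmetric])
  finally show ?thesis by simp
qed

end

text \<open>
  For a simple digraph the adjacency matrix has entries \<open>0\<close> and \<open>1\<close>, so the sum of their squares
  is the number of arcs, and \<open>sum_tree_weight_bound\<close> reads as follows.
\<close>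

lemma sum_tree_weight_le:
  assumes D: "digraph D" and h: "bij_betw h {..<n} (verts D)" and n: "n \<ge> 2"
  shows "(\<Sum>v<n. tree_weight n (adjacency D h) v) \<le>
    (1 / (real n - 1)) powr ((real n - 1) / 2) *
    ((\<Sum>u\<in>verts D. (real (out_degree D u))\<^sup>2) + real (card (arcs D))) powr ((real n - 1) / 2)"
proof -
  interpret digraph D by (rule D)
  let ?A = "adjacency D h"
  let ?F = "(\<Sum>u\<in>verts D. (real (out_degree D u))\<^sup>2) + real (card (arcs D))"
  have "(x, x) \<notin> arcs_ends D" for x using no_loops by (fastforce simp: arcs_ends_conv)
  then have diag: "?A i i = 0" for i by (simp add: adjacency_def)
  have sq: "(?A i k)\<^sup>2 = ?A i k" for i k by (simp add: adjacency_def)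
  have "real (card (arcs D)) = (\<Sum>u\<in>verts D. real (out_degree D u))"
    by (simp add: sum_out_degree[OF D, symmetric])
  then have "?F = (\<Sum>u\<in>verts D. (real (out_degree D u))\<^sup>2 + real (out_degree D u))"
    by (simp add: sum.distrib)
  also have "\<dots> = (\<Sum>i<n. (real (out_degree D (h i)))\<^sup>2 + real (out_degree D (h i)))"
    by (rule sum.reindex_bij_betw[OF h, symmetric])
  finally have F: "?F = (\<Sum>i<n. (\<Sum>k<n. ?A i k)\<^sup>2 + (\<Sum>k<n. (?A i k)\<^sup>2))"
    by (simp add: sq adjacency_row_sum[OF D h])
  let ?W = "\<Sum>v<n. tree_weight n ?A v"
  define q where "q = ?F / (real n - 1)"
  have q: "q \<ge> 0" unfolding q_def using n by (intro divide_nonneg_nonneg add_nonneg_nonneg sum_nonneg) auto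
  have "?W\<^sup>2 \<le> q ^ (n - 1)" unfolding q_def by (rule sum_tree_weight_bound[OF n diag F])
  also have "\<dots> = (q powr ((real n - 1) / 2))\<^sup>2"
  proof (cases "q = 0")
    case True
    then show ?thesis using n by simp
  next
    case False
    then have "q > 0" using q by simp
    have "(q powr ((real n - 1) / 2))\<^sup>2 = q powr ((real n - 1) / 2 + (real n - 1) / 2)"
      by (simp only: power2_eq_square powr_add)
    also have "(real n - 1) / 2 + (real n - 1) / 2 = real (n - 1)" using n by (simp add: of_nat_diff)
    finally show ?thesis using \<open>q > 0\<close> by (simp only: powr_realpow)
  qed
  finally have "?W \<le> q powr ((real n - 1) / 2)"
    by (rule power2_le_imp_le) simp
  also have "\<dots> = (1 / (real n - 1)) powr ((real n - 1) / 2) * ?F powr ((real n - 1) / 2)"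
    unfolding q_def using n by (subst powr_mult[symmetric]) (auto intro!: add_nonneg_nonneg sum_nonneg)
  finally show ?thesis .
qed

text \<open>
  Since no edge is oriented both ways, taking the two ends is a bijection from the arcs of the
  orientation to the edges of the graph.
\<close>

lemma orientation_degrees:
  assumes G: "graph G" and O: "orientation Q G"
  shows "card (edges G) = card (arcs Q)"
    and "vdegree G v = in_degree Q v + out_degree Q v"
proof -
  have Q: "digraph Q" and E: "arcs_ends Q \<union> (arcs_ends Q)\<inverse> = arcs_ends G"
    and anti: "arcs_ends Q \<inter> (arcs_ends Q)\<inverse> = {}"
    using O by (auto simp: orientation_def)
  interpret digraph Q by (rule Q)
  let ?e = "\<lambda>e. {tail Q e, head Q e}"
  have "edges G = (\<lambda>(a, b). {a, b}) ` arcs_ends G"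
    by (auto simp: edges_def arcs_ends_conv image_image)
  also have "\<dots> = (\<lambda>(a, b). {a, b}) ` arcs_ends Q"
    unfolding E[symmetric] by (auto simp: insert_commute image_iff Bex_def)
  also have "\<dots> = ?e ` arcs Q" by (simp add: arcs_ends_conv image_image)
  finally have edges: "edges G = ?e ` arcs Q" .
  have inj: "inj_on ?e (arcs Q)"
  proof (rule inj_onI)
    fix e e' assume e: "e \<in> arcs Q" "e' \<in> arcs Q" "?e e = ?e e'"
    have "\<not> (tail Q e = head Q e' \<and> head Q e = tail Q e')"
      using anti e by (auto simp: arcs_ends_conv)
    then show "e = e'" using e by (intro no_multi_arcs) (auto simp: arc_to_ends_def doubleton_eq_iff)
  qed
  show "card (edges G) = card (arcs Q)" unfolding edges using inj by (rule card_image)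
  have "{x \<in> edges G. v \<in> x} = ?e ` (in_arcs Q v \<union> out_arcs Q v)"
    unfolding edges by (auto simp: in_arcs_def out_arcs_def)
  then have "vdegree G v = card (in_arcs Q v \<union> out_arcs Q v)"
    unfolding vdegree_def
    by (simp only:) (rule card_image, rule inj_on_subset[OF inj], auto simp: in_arcs_def out_arcs_def)
  also have "\<dots> = in_degree Q v + out_degree Q v"
    unfolding in_degree_def out_degree_def
    by (rule card_Un_disjoint) (auto simp: in_arcs_def out_arcs_def dest: no_loops)
  finally show "vdegree G v = in_degree Q v + out_degree Q v" .
qed

theorem theorem1p9:
  fixes n m :: nat
  assumes "n \<ge> 2"
  shows
    "(\<forall>D :: ('a, 'b) pre_digraph.
        digraph D \<and> card (verts D) = n \<and> card (arcs D) = m \<longrightarrow>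
        real (allarb D) \<le>
          (1 / (real n - 1)) powr ((real n - 1) / 2) *
          ((\<Sum>v \<in> verts D. (real (out_degree D v))\<^sup>2) + real m) powr ((real n - 1) / 2)) \<and>
     (\<forall>(G :: ('c, 'd) pre_digraph) (Q :: ('c, 'e) pre_digraph).
        eulerian_graph G \<and> card (verts G) = n \<and> card (edges G) = m \<and>
        orientation Q G \<and> eulerian_digraph Q \<longrightarrow>
        (\<forall>v \<in> verts Q.
          real (arb Q v) \<le>
            1 / real n * (1 / (real n - 1)) powr ((real n - 1) / 2) *
            (1 / 4 * (\<Sum>u \<in> verts G. (real (vdegree G u))\<^sup>2) + real m) powr ((real n - 1) / 2)))"
proof (intro conjI allI impI ballI; elim conjE)
  fix D :: "('a, 'b) pre_digraph"
  assume D: "digraph D" and n: "card (verts D) = n" and m: "card (arcs D) = m"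
  have "finite (verts D)" using D by (simp add: digraph_def fin_digraph.finite_verts)
  then obtain h where h: "bij_betw h {..<n} (verts D)"
    using n ex_bij_betw_nat_finite[of "verts D"] by (auto simp: atLeast0LessThan)
  have "real (allarb D) = (\<Sum>i<n. real (arb D (h i)))"
    unfolding allarb_def of_nat_sum by (rule sum.reindex_bij_betw[OF h, symmetric])
  also have "\<dots> \<le> (\<Sum>v<n. tree_weight n (adjacency D h) v)"
    by (intro sum_mono arb_le_tree_weight[OF D h]) simp
  also note sum_tree_weight_le[OF D h assms]
  finally show "real (allarb D) \<le>
      (1 / (real n - 1)) powr ((real n - 1) / 2) *
      ((\<Sum>v \<in> verts D. (real (out_degree D v))\<^sup>2) + real m) powr ((real n - 1) / 2)"
    unfolding m .
next
  fix G :: "('c, 'd) pre_digraph" and Q :: "('c, 'e) pre_digraph" and v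
  assume G: "eulerian_graph G" and n: "card (verts G) = n" and m: "card (edges G) = m"
    and O: "orientation Q G" and Q: "eulerian_digraph Q" and v: "v \<in> verts Q"
  have graph: "graph G" using G by (simp add: eulerian_graph_def)
  have D: "digraph Q" and balanced: "\<And>u. u \<in> verts Q \<Longrightarrow> in_degree Q u = out_degree Q u"
    using Q by (auto simp: eulerian_digraph_def)
  have verts: "verts Q = verts G" using O by (simp add: orientation_def)
  have "finite (verts Q)" using D by (simp add: digraph_def fin_digraph.finite_verts)
  then obtain h where h: "bij_betw h {..<n} (verts Q)"
    using n verts ex_bij_betw_nat_finite[of "verts Q"] by (auto simp: atLeast0LessThan)
  obtain i where i: "i < n" "v = h i" using v h by (auto simp: bij_betw_def)
  let ?W = "tree_weight n (adjacency Q h)"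
  have const: "?W j = ?W i" if "j < n" for j
  proof (rule tree_weight_balanced[OF _ _ that i(1)])
    fix j assume "j < n"
    then have "h j \<in> verts Q" using h by (auto simp: bij_betw_def)
    then show "(\<Sum>k<n. adjacency Q h k j) = (\<Sum>k<n. adjacency Q h j k)"
      by (simp add: adjacency_row_sum[OF D h] adjacency_column_sum[OF D h] balanced)
  qed (simp add: adjacency_def)
  have "real (arb Q v) \<le> ?W i" unfolding i(2) by (rule arb_le_tree_weight[OF D h i(1)])
  also have "\<dots> = 1 / real n * (\<Sum>j<n. ?W j)" using const assms by simp
  also have "\<dots> \<le> 1 / real n * ((1 / (real n - 1)) powr ((real n - 1) / 2) *
      ((\<Sum>u\<in>verts Q. (real (out_degree Q u))\<^sup>2) + real (card (arcs Q))) powr ((real n - 1) / 2))"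
    by (intro mult_left_mono sum_tree_weight_le[OF D h assms]) simp
  also have "(\<Sum>u\<in>verts Q. (real (out_degree Q u))\<^sup>2) = 1 / 4 * (\<Sum>u\<in>verts G. (real (vdegree G u))\<^sup>2)"
    unfolding sum_distrib_left verts[symmetric]
    by (intro sum.cong refl) (simp add: orientation_degrees(2)[OF graph O] balanced power2_eq_square)
  also have "card (arcs Q) = m" using orientation_degrees(1)[OF graph O] m by simp
  finally show "real (arb Q v) \<le>
      1 / real n * (1 / (real n - 1)) powr ((real n - 1) / 2) *
      (1 / 4 * (\<Sum>u \<in> verts G. (real (vdegree G u))\<^sup>2) + real m) powr ((real n - 1) / 2)"
    by (simp only: mult.assoc)
qed

end
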